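(* For $p'=\frac12$ and every $p\in[0,1]$ with $p\neq \frac12$, we have $(|U_n^{p'}|)_{n\geq 0} \preceq_{st} (|U_n^{p}|)_{n\geq 0}$. Consequently, $(|U_n^{p}|)_{n\geq 0}$ is stochastically minimized over $p\in[0,1]$ by $p=\frac12$, i.e. $(|U_n^{1/2}|)_{n\ge0}\preceq_{st}(|U_n^p|)_{n\ge0}$ for all $p\in[0,1]$.
   Context: For $p\in[0,1]$, let $X_1^p,X_2^p,\dots$ be i.i.d. with $P(X_n^p=1)=p$ and $P(X_n^p=-1)=1-p$, and let $X_0\in\{+1,-1\}$ be independent of $X_1^p,X_2^p,\dots$ with $P(X_0=1)=P(X_0=-1)=\frac12$. Set $U_0^p=X_0$ and $U_n^p=X_0+X_1^p+\cdots+X_n^p$ for $n\ge1$. Stochastic order: for infinite-dimensional random vectors $\mathbf U=(U_n)_{n\ge0}$ and $\mathbf V=(V_n)_{n\ge0}$ (random elements of $\mathbb R^\infty$ with the product topology and its Borel $\sigma$-field), $\mathbf U\preceq_{st}\mathbf V$ means $E f(\mathbf U)\le E f(\mathbf V)$ for all bounded increasing measurable $f:\mathbb R^\infty\to\mathbb R$, where $f$ is increasing if $f(x_0,x_1,\dots)\le f(y_0,y_1,\dots)$ whenever $x_i\le y_i$ for all $i$. The random vectors need not be defined on the same probability space. *)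

theory Defs
  imports "HOL-Probability.Probability"
begin

text \<open>
  Data of the walk with parameter p: \<open>X 0\<close> is the symmetric initial sign \<open>X\<^sub>0\<close> and
  \<open>X n\<close>, for \<open>n \<ge> 1\<close>, is the step \<open>X\<^sub>n\<^sup>p\<close>. That the steps are independent of each other and
  that \<open>X\<^sub>0\<close> is independent of the sequence of steps is mutual independence of the whole family.
  The values lie in \<open>{1, -1}\<close> almost surely, since the two point probabilities add up to 1.
\<close>

definition walk_data :: "'a measure \<Rightarrow> real \<Rightarrow> (nat \<Rightarrow> 'a \<Rightarrow> real) \<Rightarrow> bool" where
  "walk_data M p X \<longleftrightarrow>
     prob_space M \<and>
     prob_space.indep_vars M (\<lambda>_. borel) X UNIV \<and>
     measure M {\<omega> \<in> space M. X 0 \<omega> = 1} = 1 / 2 \<and>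
     measure M {\<omega> \<in> space M. X 0 \<omega> = -1} = 1 / 2 \<and>
     (\<forall>n\<ge>1. measure M {\<omega> \<in> space M. X n \<omega> = 1} = p \<and>
             measure M {\<omega> \<in> space M. X n \<omega> = -1} = 1 - p)"

definition walk :: "(nat \<Rightarrow> 'a \<Rightarrow> real) \<Rightarrow> nat \<Rightarrow> 'a \<Rightarrow> real" where
  "walk X n \<omega> = X 0 \<omega> + (\<Sum>k=1..n. X k \<omega>)"

definition abs_walk :: "(nat \<Rightarrow> 'a \<Rightarrow> real) \<Rightarrow> 'a \<Rightarrow> nat \<Rightarrow> real" where
  "abs_walk X \<omega> = (\<lambda>n. \<bar>walk X n \<omega>\<bar>)"

text \<open>
  The type \<open>nat \<Rightarrow> real\<close> carries the product topology and the pointwise order, so \<open>borel\<close> and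
  \<open>mono\<close> below are the Borel sets of the product topology and coordinatewise monotonicity.
\<close>

definition stoch_le ::
  "'a measure \<Rightarrow> ('a \<Rightarrow> nat \<Rightarrow> real) \<Rightarrow> 'b measure \<Rightarrow> ('b \<Rightarrow> nat \<Rightarrow> real) \<Rightarrow> bool" where
  "stoch_le M U N V \<longleftrightarrow>
     prob_space M \<and> U \<in> borel_measurable M \<and>
     prob_space N \<and> V \<in> borel_measurable N \<and>
     (\<forall>f :: (nat \<Rightarrow> real) \<Rightarrow> real.
        f \<in> borel_measurable borel \<and> bounded (range f) \<and> mono f \<longrightarrow>
        (LINT \<omega>|M. f (U \<omega>)) \<le> (LINT \<omega>|N. f (V \<omega>)))"


text \<open>Walk data exist for every p, so results about them are not vacuous.\<close>

lemma walk_data_exists: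
  assumes "p \<in> {0..1}"
  shows "\<exists>(M :: (nat \<Rightarrow> real) measure) X. walk_data M p X"
proof -
  define D where
    "D n = distr (measure_pmf (bernoulli_pmf (if n = (0::nat) then 1 / 2 else p))) borel
             (\<lambda>b. if b then 1 else (-1::real))" for n
  have D: "prob_space (D n)" for n
    unfolding D_def by (intro prob_space.prob_space_distr prob_space_measure_pmf) simp
  have sets_D [measurable_cong]: "sets (D n) = sets borel" for n
    by (simp add: D_def)
  define M where "M = PiM UNIV D"
  define X where "X n \<omega> = \<omega> n" for n and \<omega> :: "nat \<Rightarrow> real"
  have M: "prob_space M"
    unfolding M_def by (intro prob_space_PiM D)
  have rv: "X n \<in> borel_measurable M" for n
    unfolding X_def M_def by measurable
  have distr: "distr M borel (X n) = D n" for n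
  proof -
    have "distr M borel (X n) = distr (PiM UNIV D) (D n) (\<lambda>\<omega>. \<omega> n)"
      unfolding M_def X_def by (intro distr_cong) (simp_all add: sets_D)
    also have "\<dots> = D n"
      by (intro distr_PiM_component D) simp
    finally show ?thesis .
  qed
  have "distr M (PiM UNIV (\<lambda>_. borel)) (\<lambda>x. \<lambda>i\<in>UNIV. X i x) = distr M M (\<lambda>x. x)"
    by (intro distr_cong) (auto simp: X_def M_def sets_D intro!: sets_PiM_cong)
  also have "\<dots> = PiM UNIV D"
    by (simp add: M_def)
  finally have indep: "prob_space.indep_vars M (\<lambda>_. borel) X UNIV"
    using prob_space.indep_vars_iff_distr_eq_PiM'[OF M, of UNIV X "\<lambda>_. borel"] rv
    by (simp add: distr)
  have prob: "measure M {\<omega> \<in> space M. X n \<omega> = c} =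
      measure_pmf.prob (bernoulli_pmf (if n = 0 then 1 / 2 else p)) {b. (if b then 1 else -1) = c}"
    for n c
  proof -
    have "measure M {\<omega> \<in> space M. X n \<omega> = c} = measure (distr M borel (X n)) {c}"
      using rv by (subst measure_distr) (auto intro!: arg_cong[where f = "measure M"])
    also have "\<dots> = measure_pmf.prob (bernoulli_pmf (if n = 0 then 1 / 2 else p))
        {b. (if b then 1 else -1) = c}"
      unfolding distr by (auto simp: D_def measure_distr vimage_def)
    finally show ?thesis .
  qed
  have sets_bool: "{b. (if b then 1 else (-1::real)) = 1} = {True}"
    "{b. (if b then 1 else (-1::real)) = -1} = {False}"
    by (auto split: if_splits)
  have "walk_data M p X"
    using assms by (simp add: walk_data_def M indep prob sets_bool measure_pmf_single)
  then show ?thesis by blast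
qed

end

theory Submission
  imports Defs
begin

text \<open>
  Write \<open>q = 1 - p\<close>. The steps of \<open>|U|\<close> cannot be compared directly for different parameters:
  given the sign of \<open>U\<close>, the modulus moves outward with probability \<open>p\<close> or \<open>q\<close>, and one
  of these is below \<open>1 / 2\<close>. The comparison works once the sign is forgotten. Given the past of the
  modulus up to a time at which it is at \<open>h > 0\<close>, the two signs of \<open>U\<close> have conditional
  probabilities in the ratio \<open>p ^ e : q ^ e\<close>, where \<open>e = h\<close> if 0 has been visited and
  \<open>e = h - 1\<close> otherwise: the start is at distance 1 with both signs equally likely, and each
  step outward multiplies the ratio by \<open>p / q\<close>, each step inward by \<open>q / p\<close>. At 0 the ratio
  is \<open>1 : 1\<close>, so \<open>e = 0\<close>. Hence the modulus moves outward with conditional probability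
  \<open>(p ^ (e + 1) + q ^ (e + 1)) / (p ^ e + q ^ e)\<close>, which is at least \<open>1 / 2\<close> and equals
  \<open>1 / 2\<close> for \<open>p = 1 / 2\<close> (\<open>outward_prob_ge_half\<close>, \<open>outward_prob_half\<close>).

  So \<open>|U|\<close> has the law of the first component of a Markov chain with states \<open>(h, e)\<close>, the radial
  chain (\<open>distr_abs_walk\<close>). Radial chains for different \<open>p\<close> can be driven by the same independent
  uniform variables. If the chain for \<open>1 / 2\<close> starts no farther out than the chain for \<open>p\<close>, it
  stays so (\<open>radial_run_mono\<close>): when both are at the same positive height, an outward step of the
  former forces one of the latter, and otherwise they differ by at least 2 because their heights have
  the same parity. Integrating an increasing function along this coupling gives the theorem.

  The identity of laws is checked on finite-dimensional boxes. For both chains, conditioning on the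
  first step yields a recursion for box probabilities (\<open>prob_run_in_box\<close>), and the two recursions
  are matched by an algebraic induction (\<open>walk_box_prob_radial\<close>), which is the statement about
  the ratio \<open>p ^ e : q ^ e\<close> read forward in time.
\<close>

section \<open>Binary chains driven by independent noise\<close>

text \<open>
  At each step the chain uses one fresh noise variable, and the set \<open>G s\<close> of noise values selects
  one of the two successors of the state \<open>s\<close>. Splitting off the first step rather than the last
  makes conditioning on the first step immediate; it also keeps the past out of the recursion.
\<close>

primrec run :: "('s \<Rightarrow> bool \<Rightarrow> 's) \<Rightarrow> ('s \<Rightarrow> real set) \<Rightarrow> 's \<Rightarrow> (nat \<Rightarrow> real) \<Rightarrow> nat \<Rightarrow> 's" where
  "run \<delta> G s \<xi> 0 = s"
| "run \<delta> G s \<xi> (Suc n) = run \<delta> G (\<delta> s (\<xi> 0 \<in> G s)) (\<lambda>k. \<xi> (Suc k)) n"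

text \<open>
  The probability that the first \<open>n\<close> observations of the chain, the initial one included, lie in
  \<open>A 0, ..., A (n - 1)\<close>, when the state \<open>s\<close> has its two successors with probabilities
  \<open>\<pi> s\<close> and \<open>1 - \<pi> s\<close>.
\<close>

primrec box_prob ::
  "('s \<Rightarrow> bool \<Rightarrow> 's) \<Rightarrow> ('s \<Rightarrow> real) \<Rightarrow> ('s \<Rightarrow> real) \<Rightarrow> 's \<Rightarrow> nat \<Rightarrow> (nat \<Rightarrow> real set) \<Rightarrow> real" where
  "box_prob \<delta> \<pi> obs s 0 A = 1"
| "box_prob \<delta> \<pi> obs s (Suc n) A = indicator (A 0) (obs s) *
     (\<pi> s * box_prob \<delta> \<pi> obs (\<delta> s True) n (\<lambda>k. A (Suc k)) +
      (1 - \<pi> s) * box_prob \<delta> \<pi> obs (\<delta> s False) n (\<lambda>k. A (Suc k)))"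

lemma measurable_run:
  assumes G: "\<And>s. G s \<in> sets borel"
  shows "(\<lambda>\<xi>. run \<delta> G s \<xi> n) \<in> measurable (PiM UNIV (\<lambda>_. borel)) (count_space UNIV)"
proof (induction n arbitrary: s)
  case (Suc n)
  have tail: "(\<lambda>\<xi> k. \<xi> (Suc k)) \<in> measurable (PiM UNIV (\<lambda>_. borel)) (PiM UNIV (\<lambda>_. borel :: real measure))"
    by (rule measurable_PiM_single') auto
  have first: "{\<xi> \<in> space (PiM UNIV (\<lambda>_. borel)). \<xi> 0 \<in> G s} \<in> sets (PiM UNIV (\<lambda>_::nat. borel))"
    using G[of s] by measurable
  have "(\<lambda>\<xi>. if \<xi> 0 \<in> G s then run \<delta> G (\<delta> s True) (\<lambda>k. \<xi> (Suc k)) n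
           else run \<delta> G (\<delta> s False) (\<lambda>k. \<xi> (Suc k)) n)
        \<in> measurable (PiM UNIV (\<lambda>_. borel)) (count_space UNIV)"
    by (intro measurable_If measurable_compose[OF tail Suc.IH] first)
  also have "(\<lambda>\<xi>. if \<xi> 0 \<in> G s then run \<delta> G (\<delta> s True) (\<lambda>k. \<xi> (Suc k)) n
           else run \<delta> G (\<delta> s False) (\<lambda>k. \<xi> (Suc k)) n) = (\<lambda>\<xi>. run \<delta> G s \<xi> (Suc n))"
    by (auto simp: fun_eq_iff)
  finally show ?case .
qed simp

lemma sets_run_box:
  fixes obs :: "'s \<Rightarrow> real"
  assumes "\<And>s. G s \<in> sets borel"
  shows "{\<xi>. \<forall>i<n. obs (run \<delta> G s \<xi> i) \<in> A i} \<in> sets (PiM UNIV (\<lambda>_. borel))"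
proof -
  have "{\<xi> \<in> space (PiM UNIV (\<lambda>_. borel)). \<forall>i\<in>{..<n}. run \<delta> G s \<xi> i \<in> {s. obs s \<in> A i}}
      \<in> sets (PiM UNIV (\<lambda>_. borel))"
    by (intro sets.sets_Collect_finite_All measurable_sets_Collect[OF measurable_run[OF assms]]) auto
  then show ?thesis
    by (simp add: space_PiM lessThan_iff Ball_def)
qed

lemma (in prob_space) prob_first_and_rest:
  assumes indep: "indep_vars (\<lambda>_. borel) X (UNIV :: nat set)"
    and B: "B \<in> sets borel" and E: "E \<in> sets (PiM UNIV (\<lambda>_. borel))"
  shows "prob {\<omega> \<in> space M. X 0 \<omega> \<in> B \<and> (\<lambda>n. X (Suc n) \<omega>) \<in> E} =
    prob {\<omega> \<in> space M. X 0 \<omega> \<in> B} * prob {\<omega> \<in> space M. (\<lambda>n. X (Suc n) \<omega>) \<in> E}"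
proof -
  have iv: "indep_var (PiM {0} (\<lambda>_. borel)) (\<lambda>\<omega>. restrict (\<lambda>i. X i \<omega>) {0})
       (PiM {1..} (\<lambda>_. borel)) (\<lambda>\<omega>. restrict (\<lambda>i. X i \<omega>) {1..})"
    using indep by (rule indep_var_restrict) auto
  have tail: "(\<lambda>f n. f (Suc n)) \<in> measurable (PiM {1..} (\<lambda>_. borel)) (PiM UNIV (\<lambda>_. borel :: 'b measure))"
    by (rule measurable_PiM_single') (auto simp: space_PiM)
  let ?B = "(\<lambda>f. f 0) -` B \<inter> space (PiM {0} (\<lambda>_. borel :: 'b measure))"
  let ?E = "(\<lambda>f n. f (Suc n)) -` E \<inter> space (PiM {1..} (\<lambda>_. borel :: 'b measure))"
  have "?B \<in> sets (PiM {0} (\<lambda>_. borel))" "?E \<in> sets (PiM {1..} (\<lambda>_. borel))"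
    using B E tail by (auto intro!: measurable_sets[where A = borel])
  from indep_varD[OF iv this] show ?thesis
    by (simp add: vimage_def Int_def conj_ac space_PiM)
qed

text \<open>The induction below replaces the noise sequence by its tail.\<close>

lemma (in prob_space) indep_vars_tail:
  assumes "indep_vars (\<lambda>_. N) X (UNIV :: nat set)"
  shows "indep_vars (\<lambda>_. N) (\<lambda>n. X (Suc n)) UNIV"
proof -
  have "indep_vars (\<lambda>n. PiM {Suc n} (\<lambda>_. N)) (\<lambda>n \<omega>. restrict (\<lambda>i. X i \<omega>) {Suc n}) UNIV"
    using assms by (rule indep_vars_restrict) (auto simp: disjoint_family_on_def)
  then have "indep_vars (\<lambda>_. N) (\<lambda>n \<omega>. (restrict (\<lambda>i. X i \<omega>) {Suc n}) (Suc n)) UNIV"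
    by (rule indep_vars_compose2) simp
  then show ?thesis
    by simp
qed

text \<open>
  The first noise variable decides the second state, and the remaining trajectory is a run of the same
  chain driven by the tail of the noise, which is independent of the first variable. The common
  success probability \<open>\<pi> s\<close> makes the tail again a noise sequence of the same kind.
\<close>

lemma (in prob_space) prob_run_in_box:
  fixes obs :: "'s \<Rightarrow> real"
  assumes "indep_vars (\<lambda>_. borel) X (UNIV :: nat set)"
    and G: "\<And>s. G s \<in> sets borel"
    and "\<And>n s. prob {\<omega> \<in> space M. X n \<omega> \<in> G s} = \<pi> s"
  shows "prob {\<omega> \<in> space M. \<forall>i<n. obs (run \<delta> G s (\<lambda>k. X k \<omega>) i) \<in> A i} = box_prob \<delta> \<pi> obs s n A"
  using assms(1,3)
proof (induction n arbitrary: s X A)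
  case 0
  then show ?case by (simp add: prob_space)
next
  case (Suc n)
  note indep = Suc.prems(1) and prob_G = Suc.prems(2)
  have X [measurable]: "X k \<in> borel_measurable M" for k
    using indep by (auto simp: indep_vars_def)
  note G [measurable]
  define E where "E b = {\<xi>. \<forall>i<n. obs (run \<delta> G (\<delta> s b) \<xi> i) \<in> A (Suc i)}" for b
  have E: "E b \<in> sets (PiM UNIV (\<lambda>_. borel))" for b
    unfolding E_def by (rule sets_run_box) fact
  have tail: "(\<lambda>\<omega> k. X (Suc k) \<omega>) \<in> measurable M (PiM UNIV (\<lambda>_. borel))"
    by (rule measurable_PiM_single') auto
  have prob_E: "prob {\<omega> \<in> space M. (\<lambda>k. X (Suc k) \<omega>) \<in> E b} =
      box_prob \<delta> \<pi> obs (\<delta> s b) n (\<lambda>k. A (Suc k))" for b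
    unfolding E_def mem_Collect_eq using indep_vars_tail[OF indep] prob_G by (rule Suc.IH)
  have compl: "prob {\<omega> \<in> space M. X 0 \<omega> \<in> - G s} = 1 - \<pi> s"
  proof -
    have "prob {\<omega> \<in> space M. X 0 \<omega> \<in> - G s} = prob (space M - {\<omega> \<in> space M. X 0 \<omega> \<in> G s})"
      by (intro arg_cong[where f = prob]) auto
    also have "\<dots> = 1 - \<pi> s"
      by (subst prob_compl) (simp_all add: prob_G)
    finally show ?thesis .
  qed
  have "prob {\<omega> \<in> space M. X 0 \<omega> \<in> G s \<and> (\<lambda>k. X (Suc k) \<omega>) \<in> E True \<or>
            X 0 \<omega> \<in> - G s \<and> (\<lambda>k. X (Suc k) \<omega>) \<in> E False} =
        prob ({\<omega> \<in> space M. X 0 \<omega> \<in> G s \<and> (\<lambda>k. X (Suc k) \<omega>) \<in> E True} \<union>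
              {\<omega> \<in> space M. X 0 \<omega> \<in> - G s \<and> (\<lambda>k. X (Suc k) \<omega>) \<in> E False})"
    by (intro arg_cong[where f = prob]) auto
  also have "\<dots> = prob {\<omega> \<in> space M. X 0 \<omega> \<in> G s \<and> (\<lambda>k. X (Suc k) \<omega>) \<in> E True} +
              prob {\<omega> \<in> space M. X 0 \<omega> \<in> - G s \<and> (\<lambda>k. X (Suc k) \<omega>) \<in> E False}"
  proof (rule finite_measure_Union)
    show "{\<omega> \<in> space M. X 0 \<omega> \<in> G s \<and> (\<lambda>k. X (Suc k) \<omega>) \<in> E True} \<in> events"
      by (intro sets.sets_Collect_conj measurable_sets_Collect[OF tail, unfolded Collect_mem_eq]
          measurable_sets_Collect[OF X, unfolded Collect_mem_eq]) (use E G in \<open>auto simp: space_PiM\<close>)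
    show "{\<omega> \<in> space M. X 0 \<omega> \<in> - G s \<and> (\<lambda>k. X (Suc k) \<omega>) \<in> E False} \<in> events"
      by (intro sets.sets_Collect_conj measurable_sets_Collect[OF tail, unfolded Collect_mem_eq]
          measurable_sets_Collect[OF X, unfolded Collect_mem_eq]) (use E G in \<open>auto simp: space_PiM\<close>)
  qed auto
  also have "\<dots> = \<pi> s * box_prob \<delta> \<pi> obs (\<delta> s True) n (\<lambda>k. A (Suc k)) +
      (1 - \<pi> s) * box_prob \<delta> \<pi> obs (\<delta> s False) n (\<lambda>k. A (Suc k))"
    using G[of s] by (simp only: prob_first_and_rest[OF indep _ E] borel_comp prob_E compl prob_G)
  finally have *: "prob {\<omega> \<in> space M. X 0 \<omega> \<in> G s \<and> (\<lambda>k. X (Suc k) \<omega>) \<in> E True \<or>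
            X 0 \<omega> \<in> - G s \<and> (\<lambda>k. X (Suc k) \<omega>) \<in> E False} = \<dots>" .
  \<comment> \<open>The set depends on the first noise variable only through its membership in \<open>G s\<close>.\<close>
  have split_first: "P (\<xi> \<in> G s) \<longleftrightarrow> \<xi> \<in> G s \<and> P True \<or> \<xi> \<notin> G s \<and> P False" for P \<xi>
    by (cases "\<xi> \<in> G s") auto
  have "{\<omega> \<in> space M. \<forall>i<Suc n. obs (run \<delta> G s (\<lambda>k. X k \<omega>) i) \<in> A i} =
     (if obs s \<in> A 0 then {\<omega> \<in> space M. X 0 \<omega> \<in> G s \<and> (\<lambda>k. X (Suc k) \<omega>) \<in> E True \<or>
            X 0 \<omega> \<in> - G s \<and> (\<lambda>k. X (Suc k) \<omega>) \<in> E False} else {})"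
    by (cases "obs s \<in> A 0") (simp_all add: All_less_Suc2 E_def split_first[of "\<lambda>b. \<forall>i<n. obs (run \<delta> G (\<delta> s b) _ i) \<in> A (Suc i)"])
  with * show ?case
    by simp
qed

text \<open>
  Boxes over an initial segment of the indices suffice, since a box over a finite index set becomes one
  by adding full factors.
\<close>

lemma distr_eqI_boxes:
  fixes f :: "'a \<Rightarrow> nat \<Rightarrow> real" and g :: "'b \<Rightarrow> nat \<Rightarrow> real"
  assumes M: "prob_space M" and N: "prob_space N"
    and f [measurable]: "f \<in> borel_measurable M" and g [measurable]: "g \<in> borel_measurable N"
    and boxes: "\<And>n A. (\<And>i. A i \<in> sets borel) \<Longrightarrow>
      measure M {\<omega> \<in> space M. \<forall>i<n. f \<omega> i \<in> A i} = measure N {\<omega> \<in> space N. \<forall>i<n. g \<omega> i \<in> A i}"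
  shows "distr M borel f = distr N borel g"
proof (rule measure_eqI_PiM_infinite[where I = UNIV and M = "\<lambda>_. borel"])
  interpret M: prob_space M by fact
  interpret N: prob_space N by fact
  show "finite_measure (distr M borel f)"
    using f by (intro prob_space.finite_measure M.prob_space_distr)
  fix A :: "nat \<Rightarrow> real set" and J :: "nat set"
  assume J: "finite J" and A: "\<And>i. i \<in> J \<Longrightarrow> A i \<in> sets borel"
  let ?P = "prod_emb UNIV (\<lambda>_. borel) J (Pi\<^sub>E J A)"
  define n where "n = Suc (Max J)"
  define A' where "A' i = (if i \<in> J then A i else UNIV)" for i
  have P: "?P = {x. \<forall>i<n. x i \<in> A' i}"
  proof -
    have "i < n" if "i \<in> J" for i
      using Max_ge[OF J that] by (simp add: n_def)
    then show ?thesis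
      by (auto simp: prod_emb_def PiE_iff A'_def space_PiM split: if_splits)
  qed
  have "?P \<in> sets (PiM UNIV (\<lambda>_. borel))"
    using J A by (intro sets_PiM_I) auto
  then have sets_P: "?P \<in> sets borel"
    by (simp add: sets_PiM_equal_borel)
  have boxes_eq: "measure M {\<omega> \<in> space M. \<forall>i<n. f \<omega> i \<in> A' i} = measure N {\<omega> \<in> space N. \<forall>i<n. g \<omega> i \<in> A' i}"
    using A by (intro boxes) (simp add: A'_def)
  show "emeasure (distr M borel f) ?P = emeasure (distr N borel g) ?P"
  proof -
    have "f -` ?P \<inter> space M = {\<omega> \<in> space M. \<forall>i<n. f \<omega> i \<in> A' i}"
         "g -` ?P \<inter> space N = {\<omega> \<in> space N. \<forall>i<n. g \<omega> i \<in> A' i}"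
      unfolding P by auto
    then show ?thesis
      using boxes_eq
      by (simp only: emeasure_distr[OF f sets_P] emeasure_distr[OF g sets_P]
          M.emeasure_eq_measure N.emeasure_eq_measure)
  qed
qed (simp_all add: sets_PiM_equal_borel)


section \<open>The radial chain\<close>

definition walk_step :: "int \<Rightarrow> bool \<Rightarrow> int" where
  "walk_step s b = (if b then s + 1 else s - 1)"

text \<open>
  Truncated subtraction sends both \<open>(1, 1)\<close> and \<open>(1, 0)\<close> to \<open>(0, 0)\<close>, so the difference
  \<open>h - e\<close>, which is 1 before the first visit to 0, becomes 0 there and remains so. At height 0 both
  outcomes lead to \<open>(1, 1)\<close>, so the reflection is built into the step.
\<close>

fun radial_step :: "nat \<times> nat \<Rightarrow> bool \<Rightarrow> nat \<times> nat" where
  "radial_step (h, e) b = (if b \<or> h = 0 then (Suc h, Suc e) else (h - 1, e - 1))"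

definition outward_prob :: "real \<Rightarrow> nat \<times> nat \<Rightarrow> real" where
  "outward_prob p s = (p ^ Suc (snd s) + (1 - p) ^ Suc (snd s)) / (p ^ snd s + (1 - p) ^ snd s)"

lemma walk_step_simps [simp]:
  "walk_step s True = s + 1" "walk_step s False = s - 1"
  by (simp_all add: walk_step_def)

lemma power_sum_pos:
  fixes p :: real
  assumes "p \<in> {0..1}"
  shows "p ^ e + (1 - p) ^ e > 0"
proof (cases "p = 0")
  case False
  with assms have "p ^ e > 0" "(1 - p) ^ e \<ge> 0" by auto
  then show ?thesis by linarith
qed (cases e, auto)

text \<open>
  This is Chebyshev's sum inequality: \<open>p ^ e\<close> and \<open>(1 - p) ^ e\<close> are ordered in the same way as
  \<open>p\<close> and \<open>1 - p\<close>.
\<close>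

lemma outward_prob_ge_half:
  assumes "p \<in> {0..1}"
  shows "outward_prob p s \<ge> 1 / 2"
proof -
  define e where "e = snd s"
  have "(p - (1 - p)) * (p ^ e - (1 - p) ^ e) \<ge> 0"
  proof (cases "p \<le> 1 - p")
    case True
    then show ?thesis using assms by (intro mult_nonpos_nonpos) (auto intro: power_mono)
  next
    case False
    then show ?thesis using assms by (intro mult_nonneg_nonneg) (auto intro: power_mono)
  qed
  then show ?thesis
    using power_sum_pos[OF assms, of e]
    by (simp add: outward_prob_def e_def[symmetric] field_simps)
qed

lemma outward_prob_le_1:
  assumes "p \<in> {0..1}"
  shows "outward_prob p s \<le> 1"
proof -
  define e where "e = snd s"
  have "p ^ Suc e \<le> p ^ e" "(1 - p) ^ Suc e \<le> (1 - p) ^ e"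
    using assms by (auto intro!: mult_left_le_one_le)
  then show ?thesis
    using power_sum_pos[OF assms, of e] by (simp add: outward_prob_def e_def[symmetric])
qed

lemma outward_prob_half [simp]: "outward_prob (1 / 2) s = 1 / 2"
  by (simp add: outward_prob_def field_simps)

text \<open>
  A walk started at \<open>h\<close> and \<open>-h\<close> with weights proportional to \<open>p ^ e\<close> and \<open>(1 - p) ^ e\<close> has the
  same law of its modulus as the radial chain started at \<open>(h, e)\<close>. One step of the walk turns the
  pair of weights into a pair of the same form, for \<open>(h + 1, e + 1)\<close> on the outward part and for
  \<open>(h - 1, e - 1)\<close> on the inward part; the total masses of the two parts give the transition
  probabilities of the radial chain.
\<close>

lemma walk_box_prob_radial:
  assumes p: "p \<in> {0..1}" and e: "e = h \<or> Suc e = h"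
  shows "p ^ e * box_prob walk_step (\<lambda>_. p) (\<lambda>s. \<bar>real_of_int s\<bar>) (int h) n A +
      (1 - p) ^ e * box_prob walk_step (\<lambda>_. p) (\<lambda>s. \<bar>real_of_int s\<bar>) (- int h) n A =
    (p ^ e + (1 - p) ^ e) *
      box_prob radial_step (outward_prob p) (\<lambda>s. real (fst s)) (h, e) n A"
  using e
proof (induction n arbitrary: h e A)
  case 0
  then show ?case by simp
next
  case (Suc n)
  define q where "q = 1 - p"
  define B where "B k = A (Suc k)" for k
  define W where "W s = box_prob walk_step (\<lambda>_. p) (\<lambda>s. \<bar>real_of_int s\<bar>) s n B" for s
  define Q where "Q h e = box_prob radial_step (outward_prob p) (\<lambda>s. real (fst s)) (h, e) n B" for h e
  have IH: "p ^ e * W (int h) + q ^ e * W (- int h) = (p ^ e + q ^ e) * Q h e"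
    if "e = h \<or> Suc e = h" for h e
    unfolding W_def Q_def q_def using that by (rule Suc.IH)
  have pq: "p = 1 - q" "1 - p = q" "1 - q = p" by (simp_all add: q_def)
  \<comment> \<open>\<open>T\<close> is the total weight; the outward part of the mass is \<open>T * r\<close>, the inward part
    \<open>T * (1 - r)\<close>.\<close>
  define T where "T = p ^ e + q ^ e"
  have "T > 0" unfolding T_def q_def by (rule power_sum_pos[OF p])
  define r where "r = outward_prob p (h, e)"
  have r: "T * r = p ^ Suc e + q ^ Suc e"
    using \<open>T > 0\<close> by (simp add: r_def outward_prob_def T_def q_def)
  have r': "T * (1 - r) = p ^ e * q + q ^ e * p"
  proof -
    have "T * (1 - r) = T - T * r" by (simp add: algebra_simps)
    also have "\<dots> = p ^ e * (1 - p) + q ^ e * (1 - q)"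
      unfolding r by (simp add: T_def algebra_simps)
    finally show ?thesis by (simp only: pq(2,3))
  qed
  have up: "p ^ Suc e * W (int h + 1) + q ^ Suc e * W (- int h - 1) = (p ^ Suc e + q ^ Suc e) * Q (Suc h) (Suc e)"
    proof -
    have "int (Suc h) = int h + 1" "- int (Suc h) = - int h - 1" by simp_all
    then show ?thesis using IH[of "Suc e" "Suc h"] Suc.prems by metis
  qed
  \<comment> \<open>For \<open>e > 0\<close> an inward step takes the factor \<open>p * q\<close> out of both weights.\<close>
  have down: "p ^ e * q * W (int h - 1) + q ^ e * p * W (- int h + 1) = (p ^ e * q + q ^ e * p) * Q (h - 1) (e - 1)"
    if "h > 0"
  \<comment> \<open>For \<open>e = 0\<close> the walk has not met 0 yet; its first arrival there merges the two signs.\<close>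
  proof (cases e)
    case 0
    then have "h = 1" using Suc.prems that by auto
    moreover have "q + p = 1" by (simp add: q_def)
    ultimately show ?thesis using 0 IH[of 0 0]
      by (simp add: distrib_right[symmetric])
  next
    case (Suc d)
    have "p ^ e * q * W (int h - 1) + q ^ e * p * W (- int h + 1) =
       p * q * (p ^ d * W (int (h - 1)) + q ^ d * W (- int (h - 1)))"
      using that by (simp add: Suc of_nat_diff algebra_simps)
    also have "\<dots> = p * q * ((p ^ d + q ^ d) * Q (h - 1) d)"
      using Suc.prems that Suc by (subst IH) auto
    finally show ?thesis by (simp add: Suc algebra_simps)
  qed
  show ?case
  proof (cases "h = 0")
    case True
    then have [simp]: "h = 0" "e = 0" using Suc.prems by auto
    have "p * W 1 + q * W (-1) = Q (Suc 0) (Suc 0)"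
      using up by (simp add: pq(1))
    moreover have "x = r * x + (1 - r) * x" for r x :: real
      by (simp add: algebra_simps)
    ultimately show ?thesis
      by (simp add: B_def[symmetric] W_def[symmetric] Q_def[symmetric] q_def[symmetric])
  next
    case False
    have "p ^ e * (p * W (int h + 1) + q * W (int h - 1)) + q ^ e * (p * W (- int h + 1) + q * W (- int h - 1)) =
      T * (r * Q (Suc h) (Suc e) + (1 - r) * Q (h - 1) (e - 1))"
    proof -
      have "p ^ e * (p * W (int h + 1) + q * W (int h - 1)) + q ^ e * (p * W (- int h + 1) + q * W (- int h - 1)) =
        (p ^ Suc e * W (int h + 1) + q ^ Suc e * W (- int h - 1)) +
        (p ^ e * q * W (int h - 1) + q ^ e * p * W (- int h + 1))"
        by (simp add: algebra_simps)
      also have "\<dots> = (T * r) * Q (Suc h) (Suc e) + (T * (1 - r)) * Q (h - 1) (e - 1)"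
        unfolding up r r' using False by (simp only: down)
      finally show ?thesis by (simp add: algebra_simps)
    qed
    moreover have "indicator (A 0) \<bar>real_of_int (- int h)\<bar> = (indicator (A 0) (real h) :: real)"
       "indicator (A 0) \<bar>real_of_int (int h)\<bar> = (indicator (A 0) (real h) :: real)" by simp_all
    ultimately show ?thesis using False
      by (cases "real h \<in> A 0") (simp_all add: B_def[symmetric] W_def[symmetric] Q_def[symmetric] q_def[symmetric]
        r_def[symmetric] T_def[symmetric] algebra_simps)
  qed
qed

section \<open>Monotone coupling\<close>

abbreviation radial_run :: "real \<Rightarrow> nat \<times> nat \<Rightarrow> (nat \<Rightarrow> real) \<Rightarrow> nat \<Rightarrow> nat \<times> nat" where
  "radial_run p \<equiv> run radial_step (\<lambda>s. {..<outward_prob p s})"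

text \<open>
  Equal parity is what prevents the lower chain from overtaking: chains at different heights are at
  least 2 apart, so one step cannot cross. At equal heights the threshold for an outward step is at
  least \<open>1 / 2\<close> for the chain with parameter \<open>p\<close>.
\<close>

lemma radial_run_mono:
  assumes p: "p \<in> {0..1}" and "h' \<le> h" and "even (h + h')"
  shows "fst (radial_run (1 / 2) (h', e') \<xi> n) \<le> fst (radial_run p (h, e) \<xi> n)"
  using assms(2,3)
proof (induction n arbitrary: h h' e e' \<xi>)
  case (Suc n)
  obtain k e1 where k: "radial_step (h, e) (\<xi> 0 < outward_prob p (h, e)) = (k, e1)" by fastforce
  obtain k' e1' where k': "radial_step (h', e') (\<xi> 0 < outward_prob (1 / 2) (h', e')) = (k', e1')" by fastforce
  have k_cases: "k = Suc h \<or> h = Suc k"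
    using k by (simp split: if_splits) linarith
  have k'_cases: "k' = Suc h' \<or> h' = Suc k'"
    using k' by (simp split: if_splits) linarith
  have "k' \<le> k"
  proof (cases "h' = h")
    case True
    then show ?thesis
      using k k' outward_prob_ge_half[OF p, of "(h, e)"] by (auto split: if_splits)
  next
    case False
    with Suc.prems have "h' + 2 \<le> h" by presburger
    with k_cases k'_cases show ?thesis by linarith
  qed
  moreover have "even (k + k')"
    using k_cases k'_cases Suc.prems(2) by auto
  ultimately show ?case
    unfolding run.simps lessThan_iff k k' by (rule Suc.IH)
qed simp

section \<open>Radial paths driven by uniform noise\<close>

definition uniform_noise :: "(nat \<Rightarrow> real) measure" where
  "uniform_noise = PiM UNIV (\<lambda>_. uniform_measure lborel {0..1})"

lemma prob_space_uniform: "prob_space (uniform_measure lborel {0..1::real})"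
  by (rule prob_space_uniform_measure) auto

lemma sets_uniform_noise [measurable_cong]: "sets uniform_noise = sets (PiM UNIV (\<lambda>_. borel))"
  unfolding uniform_noise_def by (intro sets_PiM_cong) auto

lemma prob_space_uniform_noise: "prob_space uniform_noise"
  unfolding uniform_noise_def by (intro prob_space_PiM prob_space_uniform)

lemma distr_uniform_noise_component:
  "distr uniform_noise borel (\<lambda>\<xi>. \<xi> n) = uniform_measure lborel {0..1}"
proof -
  have "distr uniform_noise borel (\<lambda>\<xi>. \<xi> n) =
      distr (PiM UNIV (\<lambda>_. uniform_measure lborel {0..1})) (uniform_measure lborel {0..1}) (\<lambda>\<xi>. \<xi> n)"
    unfolding uniform_noise_def by (intro distr_cong) auto
  also have "\<dots> = uniform_measure lborel {0..1}"
    by (intro distr_PiM_component prob_space_uniform) simp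
  finally show ?thesis .
qed

lemma indep_vars_uniform_noise:
  "prob_space.indep_vars uniform_noise (\<lambda>_. borel) (\<lambda>n \<xi>. \<xi> n) UNIV"
proof -
  have "distr uniform_noise (PiM UNIV (\<lambda>_. borel)) (\<lambda>\<xi>. \<lambda>i\<in>UNIV. \<xi> i) = distr uniform_noise uniform_noise (\<lambda>\<xi>. \<xi>)"
    by (intro distr_cong) (auto simp: sets_uniform_noise)
  also have "\<dots> = PiM UNIV (\<lambda>_. uniform_measure lborel {0..1})"
    by (simp add: uniform_noise_def)
  finally show ?thesis
    using prob_space.indep_vars_iff_distr_eq_PiM'[OF prob_space_uniform_noise, of UNIV "\<lambda>n \<xi>. \<xi> n" "\<lambda>_. borel"]
    by (simp add: distr_uniform_noise_component)
qed

lemma prob_uniform_noise_less: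
  assumes "0 \<le> r" "r \<le> 1"
  shows "measure uniform_noise {\<xi> \<in> space uniform_noise. \<xi> n \<in> {..<r}} = r"
proof -
  have "measure uniform_noise {\<xi> \<in> space uniform_noise. \<xi> n \<in> {..<r}} =
      measure (distr uniform_noise borel (\<lambda>\<xi>. \<xi> n)) {..<r}"
    by (subst measure_distr) (auto intro!: arg_cong[where f = "measure uniform_noise"])
  also have "\<dots> = measure lborel ({0..1} \<inter> {..<r})"
    unfolding distr_uniform_noise_component by (subst measure_uniform_measure) auto
  also have "{0..1} \<inter> {..<r} = {0..<r}"
    using assms by auto
  finally show ?thesis using assms by simp
qed

text \<open>The start at \<open>(1, 0)\<close> reflects that both signs of the initial position are equally likely.\<close>

definition radial_path :: "real \<Rightarrow> (nat \<Rightarrow> real) \<Rightarrow> nat \<Rightarrow> real" where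
  "radial_path p \<xi> = (\<lambda>n. real (fst (radial_run p (1, 0) \<xi> n)))"

lemma measurable_radial_path: "radial_path p \<in> borel_measurable uniform_noise"
proof (rule measurable_coordinatewise_then_product)
  fix n
  have "(\<lambda>\<xi>. radial_run p (1, 0) \<xi> n) \<in> measurable uniform_noise (count_space UNIV)"
    using measurable_run[of "\<lambda>s. {..<outward_prob p s}"]
    by (simp add: measurable_cong_sets[OF sets_uniform_noise refl])
  then show "(\<lambda>\<xi>. radial_path p \<xi> n) \<in> borel_measurable uniform_noise"
    unfolding radial_path_def by (rule measurable_compose) simp
qed

lemma prob_radial_path_in_box:
  assumes p: "p \<in> {0..1}"
  shows "measure uniform_noise {\<xi> \<in> space uniform_noise. \<forall>i<n. radial_path p \<xi> i \<in> A i} =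
    box_prob radial_step (outward_prob p) (\<lambda>s. real (fst s)) (1, 0) n A"
proof -
  have "0 \<le> outward_prob p s" for s
    using outward_prob_ge_half[OF p, of s] by simp
  then show ?thesis
    unfolding radial_path_def
    using prob_uniform_noise_less outward_prob_le_1[OF p]
    by (intro prob_space.prob_run_in_box[OF prob_space_uniform_noise indep_vars_uniform_noise]) auto
qed

section \<open>The law of the modulus of the walk\<close>

lemma run_walk_step:
  assumes "\<And>k. X k = 1 \<or> X k = (-1::real)"
  shows "real_of_int (run walk_step (\<lambda>_. {1}) s X n) = real_of_int s + (\<Sum>k<n. X k)"
  using assms
proof (induction n arbitrary: s X)
  case (Suc n)
  show ?case
  proof -
    have "real_of_int (walk_step s (X 0 = 1)) = real_of_int s + X 0"
      using Suc.prems[of 0] by (auto simp: walk_step_def)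
    then show ?thesis
      using Suc.IH[of "\<lambda>k. X (Suc k)"] Suc.prems
      by (simp add: sum.lessThan_Suc_shift del: sum.lessThan_Suc)
  qed
qed simp

lemma measurable_abs_walk:
  assumes "walk_data M p X"
  shows "abs_walk X \<in> borel_measurable M"
proof (rule measurable_coordinatewise_then_product)
  interpret prob_space M using assms by (simp add: walk_data_def)
  have [measurable]: "X k \<in> borel_measurable M" for k
    using assms by (auto simp: walk_data_def indep_vars_def)
  show "(\<lambda>\<omega>. abs_walk X \<omega> n) \<in> borel_measurable M" for n
    unfolding abs_walk_def walk_def by measurable
qed

lemma walk_data_AE_signs:
  assumes "walk_data M p X"
  shows "AE \<omega> in M. \<forall>k. X k \<omega> = 1 \<or> X k \<omega> = -1"
proof -
  interpret prob_space M using assms by (simp add: walk_data_def)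
  have [measurable]: "X k \<in> borel_measurable M" for k
    using assms by (auto simp: walk_data_def indep_vars_def)
  have "AE \<omega> in M. X k \<omega> = 1 \<or> X k \<omega> = -1" for k
  proof -
    have "prob {\<omega> \<in> space M. X k \<omega> = 1 \<or> X k \<omega> = -1} =
        prob ({\<omega> \<in> space M. X k \<omega> = 1} \<union> {\<omega> \<in> space M. X k \<omega> = -1})"
      by (intro arg_cong[where f = prob]) auto
    also have "\<dots> = prob {\<omega> \<in> space M. X k \<omega> = 1} + prob {\<omega> \<in> space M. X k \<omega> = -1}"
      by (rule finite_measure_Union) auto
    also have "\<dots> = 1"
      using assms by (cases "k = 0") (auto simp: walk_data_def)
    finally show ?thesis
      by (subst (asm) prob_Collect_eq_1) auto
  qed
  then show ?thesis by (simp add: AE_all_countable)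
qed

text \<open>
  Almost surely, the walk after its initial position \<open>1\<close> or \<open>-1\<close> is a run of the integer chain
  driven by the later steps, which are independent of the initial sign.
\<close>

lemma prob_abs_walk_in_box:
  assumes wd: "walk_data M p X" and A: "\<And>i. A i \<in> sets borel"
  shows "measure M {\<omega> \<in> space M. \<forall>i<n. abs_walk X \<omega> i \<in> A i} =
    (box_prob walk_step (\<lambda>_. p) (\<lambda>s. \<bar>real_of_int s\<bar>) 1 n A +
     box_prob walk_step (\<lambda>_. p) (\<lambda>s. \<bar>real_of_int s\<bar>) (-1) n A) / 2"
proof -
  interpret prob_space M using wd by (simp add: walk_data_def)
  have indep: "indep_vars (\<lambda>_. borel) X UNIV"
    using wd by (simp add: walk_data_def)
  have X [measurable]: "X k \<in> borel_measurable M" for k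
    using indep by (auto simp: indep_vars_def)
  note [measurable] = A
  define E where "E s = {\<xi>. \<forall>i<n. \<bar>real_of_int (run walk_step (\<lambda>_. {1}) s \<xi> i)\<bar> \<in> A i}" for s
  have E: "E s \<in> sets (PiM UNIV (\<lambda>_. borel))" for s
    unfolding E_def by (rule sets_run_box) auto
  have tail: "(\<lambda>\<omega> k. X (Suc k) \<omega>) \<in> measurable M (PiM UNIV (\<lambda>_. borel))"
    by (rule measurable_PiM_single') auto
  have ev: "{\<omega> \<in> space M. X 0 \<omega> \<in> {c} \<and> (\<lambda>k. X (Suc k) \<omega>) \<in> E s} \<in> events" for c s
    by (intro sets.sets_Collect_conj measurable_sets_Collect[OF tail, unfolded Collect_mem_eq]
          measurable_sets_Collect[OF X, unfolded Collect_mem_eq]) (use E in \<open>auto simp: space_PiM\<close>)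
  have prob_E: "prob {\<omega> \<in> space M. (\<lambda>k. X (Suc k) \<omega>) \<in> E s} =
      box_prob walk_step (\<lambda>_. p) (\<lambda>s. \<bar>real_of_int s\<bar>) s n A" for s
    unfolding E_def mem_Collect_eq using wd
    by (intro prob_run_in_box indep_vars_tail indep) (auto simp: walk_data_def)
  have "prob {\<omega> \<in> space M. \<forall>i<n. abs_walk X \<omega> i \<in> A i} =
      prob ({\<omega> \<in> space M. X 0 \<omega> \<in> {1} \<and> (\<lambda>k. X (Suc k) \<omega>) \<in> E 1} \<union>
            {\<omega> \<in> space M. X 0 \<omega> \<in> {-1} \<and> (\<lambda>k. X (Suc k) \<omega>) \<in> E (-1)})"
  proof (rule finite_measure_eq_AE)
    show "AE \<omega> in M. \<omega> \<in> {\<omega> \<in> space M. \<forall>i<n. abs_walk X \<omega> i \<in> A i} \<longleftrightarrow>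
      \<omega> \<in> {\<omega> \<in> space M. X 0 \<omega> \<in> {1} \<and> (\<lambda>k. X (Suc k) \<omega>) \<in> E 1} \<union>
            {\<omega> \<in> space M. X 0 \<omega> \<in> {-1} \<and> (\<lambda>k. X (Suc k) \<omega>) \<in> E (-1)}"
      using walk_data_AE_signs[OF wd]
    proof eventually_elim
      case (elim \<omega>)
      have "walk X i \<omega> = real_of_int (run walk_step (\<lambda>_. {1}) s (\<lambda>k. X (Suc k) \<omega>) i)"
        if "X 0 \<omega> = real_of_int s" for i s
        using elim that
        by (subst run_walk_step)
          (auto simp: walk_def sum.atLeast1_atMost_eq)
      from this[of 1] this[of "-1"] show ?case
        using elim spec[OF elim, of 0] by (cases "X 0 \<omega> = 1") (simp_all add: E_def abs_walk_def)
    qed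
    have [measurable]: "(\<lambda>\<omega>. abs_walk X \<omega> i) \<in> borel_measurable M" for i
      unfolding abs_walk_def walk_def by measurable
    show "{\<omega> \<in> space M. \<forall>i<n. abs_walk X \<omega> i \<in> A i} \<in> events"
      by measurable
  qed (intro sets.Un ev)
  also have "\<dots> = prob {\<omega> \<in> space M. X 0 \<omega> \<in> {1} \<and> (\<lambda>k. X (Suc k) \<omega>) \<in> E 1} +
      prob {\<omega> \<in> space M. X 0 \<omega> \<in> {-1} \<and> (\<lambda>k. X (Suc k) \<omega>) \<in> E (-1)}"
    by (rule finite_measure_Union[OF ev ev]) auto
  also have "\<dots> = 1 / 2 * box_prob walk_step (\<lambda>_. p) (\<lambda>s. \<bar>real_of_int s\<bar>) 1 n A +
     1 / 2 * box_prob walk_step (\<lambda>_. p) (\<lambda>s. \<bar>real_of_int s\<bar>) (-1) n A"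
  proof -
    have "prob {\<omega> \<in> space M. X 0 \<omega> \<in> {1}} = 1 / 2" "prob {\<omega> \<in> space M. X 0 \<omega> \<in> {-1}} = 1 / 2"
      using wd by (simp_all add: walk_data_def)
    moreover have "{1} \<in> sets (borel :: real measure)" "{-1} \<in> sets (borel :: real measure)"
      by simp_all
    ultimately show ?thesis
      by (simp only: prob_first_and_rest[OF indep _ E] prob_E)
  qed
  finally show ?thesis by (simp add: add_divide_distrib)
qed

text \<open>
  The box probabilities are the case \<open>h = 1\<close>, \<open>e = 0\<close> of the algebraic identity, where both
  weights are 1.
\<close>

lemma distr_abs_walk:
  assumes wd: "walk_data M p X" and p: "p \<in> {0..1}"
  shows "distr M borel (abs_walk X) = distr uniform_noise borel (radial_path p)"
proof (rule distr_eqI_boxes)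
  show "prob_space M" using wd by (simp add: walk_data_def)
  fix n and A :: "nat \<Rightarrow> real set"
  assume A: "\<And>i. A i \<in> sets borel"
  show "measure M {\<omega> \<in> space M. \<forall>i<n. abs_walk X \<omega> i \<in> A i} =
      measure uniform_noise {\<xi> \<in> space uniform_noise. \<forall>i<n. radial_path p \<xi> i \<in> A i}"
    using walk_box_prob_radial[OF p, of 0 1 n A]
    by (simp add: prob_abs_walk_in_box[OF wd A] prob_radial_path_in_box[OF p])
qed (intro prob_space_uniform_noise measurable_abs_walk[OF wd] measurable_radial_path)+

lemma abs_walk_half_stoch_le:
  assumes X: "walk_data M (1 / 2) X" and Y: "walk_data N p Y" and p: "p \<in> {0..1}"
  shows "stoch_le M (abs_walk X) N (abs_walk Y)"
  unfolding stoch_le_def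
proof (intro conjI allI impI)
  show "prob_space M" "prob_space N"
    using X Y by (simp_all add: walk_data_def)
  show mX: "abs_walk X \<in> borel_measurable M" and mY: "abs_walk Y \<in> borel_measurable N"
    using X Y by (auto intro: measurable_abs_walk)
  fix f :: "(nat \<Rightarrow> real) \<Rightarrow> real"
  assume f: "f \<in> borel_measurable borel \<and> bounded (range f) \<and> mono f"
  then have [measurable]: "f \<in> borel_measurable borel" and "mono f" by auto
  note [measurable] = measurable_radial_path
  interpret U: prob_space uniform_noise by (rule prob_space_uniform_noise)
  from f obtain C where "\<And>x. \<bar>f x\<bar> \<le> C" by (auto simp: bounded_iff)
  then have int: "integrable uniform_noise (\<lambda>\<xi>. f (radial_path r \<xi>))" for r
    by (intro U.integrable_const_bound[where B = C]) auto
  have "(LINT \<omega>|M. f (abs_walk X \<omega>)) = (LINT x|distr M borel (abs_walk X). f x)"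
    using mX by (simp add: integral_distr)
  also have "\<dots> = (LINT \<xi>|uniform_noise. f (radial_path (1 / 2) \<xi>))"
    using distr_abs_walk[OF X] by (simp add: integral_distr)
  also have "\<dots> \<le> (LINT \<xi>|uniform_noise. f (radial_path p \<xi>))"
    using radial_run_mono[OF p, of 1 1 0 _ _ 0]
    by (intro integral_mono int monoD[OF \<open>mono f\<close>]) (simp add: radial_path_def le_fun_def)
  also have "\<dots> = (LINT x|distr N borel (abs_walk Y). f x)"
    using distr_abs_walk[OF Y p] by (simp add: integral_distr)
  also have "\<dots> = (LINT \<omega>|N. f (abs_walk Y \<omega>))"
    using mY by (simp add: integral_distr)
  finally show "(LINT \<omega>|M. f (abs_walk X \<omega>)) \<le> (LINT \<omega>|N. f (abs_walk Y \<omega>))" .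
qed

theorem theorem2:
  fixes M :: "'a measure" and X :: "nat \<Rightarrow> 'a \<Rightarrow> real"
  assumes "walk_data M (1 / 2) X"
  shows "(\<forall>p\<in>{0..1}. p \<noteq> 1 / 2 \<longrightarrow>
            (\<forall>(N :: 'b measure) Y. walk_data N p Y \<longrightarrow>
               stoch_le M (abs_walk X) N (abs_walk Y))) \<and>
         (\<forall>p\<in>{0..1}.
            (\<forall>(N :: 'b measure) Y. walk_data N p Y \<longrightarrow>
               stoch_le M (abs_walk X) N (abs_walk Y)))"
  using abs_walk_half_stoch_le[OF assms] by blast

end
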